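(* Let $\Omega\subset\mathbb{R}^2$ be open and let $\varphi:\Omega\to\mathbb{R}$, $(y,z)\mapsto\varphi(y,z)$, be a smooth solution of the Born-Infeld equation $$(1+\varphi_{y}^{2})\varphi_{zz}-2\varphi_{y}\varphi_{z}\varphi_{yz}+(\varphi_{z}^{2}-1)\varphi_{yy}=0 .$$ Consider the graph $X(y,z)=(\varphi(y,z),y,z)$ over the timelike plane $\{x=0\}$ in the Lorentz-Minkowski space $\mathbb{L}^3=(\mathbb{R}^3,dx^2+dy^2-dz^2)$, and let $\Omega'\subset\Omega$ be the set of non-singular points, i.e. the points where the determinant $EG-F^2$ of the first fundamental form of $X$ is nonzero. Then the restriction of $X$ to $\Omega'$ is a minimal graph (its mean curvature $H$ vanishes at every point of $\Omega'$), and at each point of $\Omega'$ it is either spacelike or timelike; that is, away from singular points the graph of $\varphi$ is a spacelike minimal graph, or a timelike minimal graph, or a combination of both.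
   Context: Write $\langle\cdot,\cdot\rangle_L$ for the metric $dx^2+dy^2-dz^2$ on $\mathbb{R}^3$. For $X(y,z)=(\varphi(y,z),y,z)$ put $E=\langle X_y,X_y\rangle_L$, $F=\langle X_y,X_z\rangle_L$, $G=\langle X_z,X_z\rangle_L$. The surface is non-degenerate at a point if $EG-F^2\neq0$; it is spacelike there if the induced metric on the tangent plane is positive definite ($EG-F^2>0$) and timelike there if the induced metric is Lorentzian ($EG-F^2<0$). Singular points are those where the tangent plane degenerates, i.e. $EG-F^2=0$. At a non-degenerate point let $N$ be a unit normal, meaning $\langle N,X_y\rangle_L=\langle N,X_z\rangle_L=0$ and $\langle N,N\rangle_L=\epsilon$, where $\epsilon=-1$ if the surface is spacelike and $\epsilon=1$ if it is timelike. With $e=\langle N,X_{yy}\rangle_L$, $f=\langle N,X_{yz}\rangle_L$, $g=\langle N,X_{zz}\rangle_L$, the mean curvature is $$H=\frac{\epsilon}{2}\,\frac{eG-2fF+gE}{EG-F^2}.$$ A graph is called minimal if $H\equiv0$. *)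

theory Defs
  imports "HOL-Analysis.Analysis"
begin

text \<open>
  Class $C^k$: every directional derivative of \<open>f\<close> is again of class $C^{k-1}$. Only meant
  for open \<open>S\<close>, since the derivatives are taken with the full filter \<open>at x\<close>.
\<close>

fun Ck_on ::
  "nat \<Rightarrow> 'a::euclidean_space set \<Rightarrow> ('a \<Rightarrow> 'b::real_normed_vector) \<Rightarrow> bool" where
  "Ck_on 0 S f \<longleftrightarrow> continuous_on S f"
| "Ck_on (Suc k) S f \<longleftrightarrow>
     (\<forall>x\<in>S. f differentiable at x) \<and>
     (\<forall>v. Ck_on k S (\<lambda>x. frechet_derivative f (at x) v))"

definition smooth_on :: "'a::euclidean_space set \<Rightarrow> ('a \<Rightarrow> 'b::real_normed_vector) \<Rightarrow> bool" where
  "smooth_on S f \<longleftrightarrow> (\<forall>k. Ck_on k S f)"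

text \<open>Points of the parameter plane are pairs \<open>(y, z)\<close>.\<close>

definition partial_y :: "(real \<times> real \<Rightarrow> 'a::real_normed_vector) \<Rightarrow> real \<times> real \<Rightarrow> 'a" where
  "partial_y f p = vector_derivative (\<lambda>t. f (t, snd p)) (at (fst p))"

definition partial_z :: "(real \<times> real \<Rightarrow> 'a::real_normed_vector) \<Rightarrow> real \<times> real \<Rightarrow> 'a" where
  "partial_z f p = vector_derivative (\<lambda>t. f (fst p, t)) (at (snd p))"

definition born_infeld_at :: "(real \<times> real \<Rightarrow> real) \<Rightarrow> real \<times> real \<Rightarrow> bool" where
  "born_infeld_at \<phi> p \<longleftrightarrow>
     (1 + (partial_y \<phi> p)\<^sup>2) * partial_z (partial_z \<phi>) p
     - 2 * partial_y \<phi> p * partial_z \<phi> p * partial_z (partial_y \<phi>) p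
     + ((partial_z \<phi> p)\<^sup>2 - 1) * partial_y (partial_y \<phi>) p = 0"

text \<open>Coordinates 1, 2, 3 of \<open>real^3\<close> are $x$, $y$, $z$; the $z$-axis is the timelike one.\<close>

definition lorentz :: "real^3 \<Rightarrow> real^3 \<Rightarrow> real" where
  "lorentz u v = u $ 1 * v $ 1 + u $ 2 * v $ 2 - u $ 3 * v $ 3"

definition graph_map :: "(real \<times> real \<Rightarrow> real) \<Rightarrow> real \<times> real \<Rightarrow> real^3" where
  "graph_map \<phi> p = vector [\<phi> p, fst p, snd p]"

definition coeff_E :: "(real \<times> real \<Rightarrow> real^3) \<Rightarrow> real \<times> real \<Rightarrow> real" where
  "coeff_E X p = lorentz (partial_y X p) (partial_y X p)"

definition coeff_F :: "(real \<times> real \<Rightarrow> real^3) \<Rightarrow> real \<times> real \<Rightarrow> real" where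
  "coeff_F X p = lorentz (partial_y X p) (partial_z X p)"

definition coeff_G :: "(real \<times> real \<Rightarrow> real^3) \<Rightarrow> real \<times> real \<Rightarrow> real" where
  "coeff_G X p = lorentz (partial_z X p) (partial_z X p)"

definition first_form_det :: "(real \<times> real \<Rightarrow> real^3) \<Rightarrow> real \<times> real \<Rightarrow> real" where
  "first_form_det X p = coeff_E X p * coeff_G X p - (coeff_F X p)\<^sup>2"

definition nonsingular_points ::
  "(real \<times> real \<Rightarrow> real^3) \<Rightarrow> (real \<times> real) set \<Rightarrow> (real \<times> real) set" where
  "nonsingular_points X S = {p \<in> S. first_form_det X p \<noteq> 0}"

text \<open>
  For a differentiable graph the two spanning vectors $(\varphi_y,1,0)$ and $(\varphi_z,0,1)$
  are always linearly independent, so this is a plane.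
\<close>

definition tangent_plane :: "(real \<times> real \<Rightarrow> real^3) \<Rightarrow> real \<times> real \<Rightarrow> (real^3) set" where
  "tangent_plane X p = span {partial_y X p, partial_z X p}"

definition spacelike_at :: "(real \<times> real \<Rightarrow> real^3) \<Rightarrow> real \<times> real \<Rightarrow> bool" where
  "spacelike_at X p \<longleftrightarrow> (\<forall>v\<in>tangent_plane X p. v \<noteq> 0 \<longrightarrow> lorentz v v > 0)"

text \<open>
  Lorentzian means signature $(1,1)$: the tangent plane has a pseudo-orthonormal basis. The
  conditions on \<open>u\<close> and \<open>v\<close> already force linear independence.
\<close>

definition timelike_at :: "(real \<times> real \<Rightarrow> real^3) \<Rightarrow> real \<times> real \<Rightarrow> bool" where
  "timelike_at X p \<longleftrightarrow>
     (\<exists>u\<in>tangent_plane X p. \<exists>v\<in>tangent_plane X p.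
        lorentz u u = 1 \<and> lorentz v v = -1 \<and> lorentz u v = 0)"

text \<open>Only meaningful at non-degenerate points, where not spacelike means timelike.\<close>

definition causal_sign :: "(real \<times> real \<Rightarrow> real^3) \<Rightarrow> real \<times> real \<Rightarrow> real" where
  "causal_sign X p = (if spacelike_at X p then -1 else 1)"

definition unit_normal_at :: "(real \<times> real \<Rightarrow> real^3) \<Rightarrow> real \<times> real \<Rightarrow> real^3 \<Rightarrow> bool" where
  "unit_normal_at X p N \<longleftrightarrow>
     lorentz N (partial_y X p) = 0 \<and> lorentz N (partial_z X p) = 0 \<and>
     lorentz N N = causal_sign X p"

definition mean_curvature ::
  "(real \<times> real \<Rightarrow> real^3) \<Rightarrow> real^3 \<Rightarrow> real \<times> real \<Rightarrow> real" where
  "mean_curvature X N p =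
     (let e = lorentz N (partial_y (partial_y X) p);
          f = lorentz N (partial_z (partial_y X) p);
          g = lorentz N (partial_z (partial_z X) p)
      in causal_sign X p / 2 *
           ((e * coeff_G X p - 2 * f * coeff_F X p + g * coeff_E X p) / first_form_det X p))"

text \<open>
  The unit normal is determined only up to sign, and changing it changes the sign of $H$; so
  $H = 0$ is required for every choice. Existence of a unit normal is part of the definition,
  which keeps the condition from being vacuous.
\<close>

definition minimal_on :: "(real \<times> real \<Rightarrow> real^3) \<Rightarrow> (real \<times> real) set \<Rightarrow> bool" where
  "minimal_on X S \<longleftrightarrow>
     (\<forall>p\<in>S. first_form_det X p \<noteq> 0 \<and>
        (\<exists>N. unit_normal_at X p N) \<and>
        (\<forall>N. unit_normal_at X p N \<longrightarrow> mean_curvature X N p = 0))"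

end

theory Submission
  imports Defs
begin

text \<open>
  With \<open>a = \<phi>\<^sub>y\<close> and \<open>b = \<phi>\<^sub>z\<close> the tangent vectors are \<open>(a, 1, 0)\<close> and \<open>(b, 0, 1)\<close>, so
  \<open>E = a\<^sup>2 + 1\<close>, \<open>F = a b\<close>, \<open>G = b\<^sup>2 - 1\<close> and \<open>E G - F\<^sup>2 = b\<^sup>2 - a\<^sup>2 - 1\<close>. Every normal vector is a
  multiple of \<open>(1, -a, b)\<close>, and the second derivatives of the graph have only an \<open>x\<close>-component;
  hence \<open>e G - 2 f F + g E\<close> is that multiple of the Born-Infeld expression. Since \<open>E > 0\<close>, the sign
  of \<open>E G - F\<^sup>2\<close> decides the causal character by completing the square.
\<close>

section \<open>Partial derivatives along coordinate lines\<close>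

lemma vector_3_eq_sum_axis:
  "(vector [a, b, c] :: real^3) = a *\<^sub>R axis 1 1 + b *\<^sub>R axis 2 1 + c *\<^sub>R axis 3 1"
  by (simp add: vec_eq_iff forall_3 axis_def)

text \<open>After expansion along the axes, each summand is a scalar function times a fixed vector,
  a bounded linear image of that function, so the sum rule applies.\<close>

lemma has_vector_derivative_vector_3:
  fixes f g h :: "real \<Rightarrow> real"
  assumes "(f has_vector_derivative f') F" "(g has_vector_derivative g') F"
    and "(h has_vector_derivative h') F"
  shows "((\<lambda>t. vector [f t, g t, h t] :: real^3) has_vector_derivative vector [f', g', h']) F"
  unfolding vector_3_eq_sum_axis
  by (intro has_vector_derivative_add
      bounded_linear.has_vector_derivative[OF bounded_linear_scaleR_left] assms)

text \<open>Chain rule along the line \<open>t \<mapsto> (t, snd p)\<close>, whose velocity is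
  \<open>(1, 0)\<close>.\<close>

lemma has_vector_derivative_partial_y:
  assumes "f differentiable at p"
  shows "((\<lambda>t. f (t, snd p)) has_vector_derivative frechet_derivative f (at p) (1, 0)) (at (fst p))"
proof -
  have "(f has_derivative frechet_derivative f (at p)) (at (fst p, snd p))"
    using assms by (simp add: frechet_derivative_works)
  moreover have "((\<lambda>t. (t, snd p)) has_vector_derivative (1, 0)) (at (fst p))"
    by (intro has_vector_derivative_Pair derivative_intros)
  ultimately show ?thesis
    using vector_derivative_diff_chain_within[of "\<lambda>t. (t, snd p)" "(1, 0)" "fst p" UNIV f]
    by (simp add: o_def has_derivative_at_withinI)
qed

lemma has_vector_derivative_partial_z:
  assumes "f differentiable at p"
  shows "((\<lambda>t. f (fst p, t)) has_vector_derivative frechet_derivative f (at p) (0, 1)) (at (snd p))"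
proof -
  have "(f has_derivative frechet_derivative f (at p)) (at (fst p, snd p))"
    using assms by (simp add: frechet_derivative_works)
  moreover have "((\<lambda>t. (fst p, t)) has_vector_derivative (0, 1)) (at (snd p))"
    by (intro has_vector_derivative_Pair derivative_intros)
  ultimately show ?thesis
    using vector_derivative_diff_chain_within[of "\<lambda>t. (fst p, t)" "(0, 1)" "snd p" UNIV f]
    by (simp add: o_def has_derivative_at_withinI)
qed

lemma partial_y_eq_frechet_derivative:
  "f differentiable at p \<Longrightarrow> partial_y f p = frechet_derivative f (at p) (1, 0)"
  unfolding partial_y_def by (intro vector_derivative_at has_vector_derivative_partial_y)

lemma partial_z_eq_frechet_derivative:
  "f differentiable at p \<Longrightarrow> partial_z f p = frechet_derivative f (at p) (0, 1)"
  unfolding partial_z_def by (intro vector_derivative_at has_vector_derivative_partial_z)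

text \<open>Partial derivatives are local. This allows a formula for a first derivative that is
  known only on \<open>S\<close> to be differentiated again.\<close>

lemma partial_y_cong_open:
  assumes "open S" "p \<in> S" "\<And>q. q \<in> S \<Longrightarrow> f q = g q"
  shows "partial_y f p = partial_y g p"
proof -
  have "isCont (\<lambda>t. (t, snd p)) (fst p)"
    by (intro continuous_intros)
  then have "\<forall>\<^sub>F t in nhds (fst p). (t, snd p) \<in> S"
    using assms(1,2) by (simp add: continuous_at_open eventually_nhds)
  \<comment> \<open>The guard \<open>t \<in> UNIV\<close> gives the fact the shape of the premise of
    \<open>vector_derivative_cong_eq\<close>.\<close>
  then have "\<forall>\<^sub>F t in nhds (fst p). t \<in> UNIV \<longrightarrow> f (t, snd p) = g (t, snd p)"
    by (rule eventually_mono) (use assms(3) in auto)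
  then show ?thesis
    unfolding partial_y_def by (rule vector_derivative_cong_eq) simp_all
qed

lemma partial_z_cong_open:
  assumes "open S" "p \<in> S" "\<And>q. q \<in> S \<Longrightarrow> f q = g q"
  shows "partial_z f p = partial_z g p"
proof -
  have "isCont (\<lambda>t. (fst p, t)) (snd p)"
    by (intro continuous_intros)
  then have "\<forall>\<^sub>F t in nhds (snd p). (fst p, t) \<in> S"
    using assms(1,2) by (simp add: continuous_at_open eventually_nhds)
  then have "\<forall>\<^sub>F t in nhds (snd p). t \<in> UNIV \<longrightarrow> f (fst p, t) = g (fst p, t)"
    by (rule eventually_mono) (use assms(3) in auto)
  then show ?thesis
    unfolding partial_z_def by (rule vector_derivative_cong_eq) simp_all
qed

lemma partial_y_vector_3:
  fixes f g h :: "real \<times> real \<Rightarrow> real"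
  assumes "f differentiable at p" "g differentiable at p" "h differentiable at p"
  shows "partial_y (\<lambda>q. vector [f q, g q, h q] :: real^3) p
           = vector [partial_y f p, partial_y g p, partial_y h p]"
  unfolding assms[THEN partial_y_eq_frechet_derivative]
  unfolding partial_y_def
  by (intro vector_derivative_at has_vector_derivative_vector_3 has_vector_derivative_partial_y assms)

lemma partial_z_vector_3:
  fixes f g h :: "real \<times> real \<Rightarrow> real"
  assumes "f differentiable at p" "g differentiable at p" "h differentiable at p"
  shows "partial_z (\<lambda>q. vector [f q, g q, h q] :: real^3) p
           = vector [partial_z f p, partial_z g p, partial_z h p]"
  unfolding assms[THEN partial_z_eq_frechet_derivative]
  unfolding partial_z_def
  by (intro vector_derivative_at has_vector_derivative_vector_3 has_vector_derivative_partial_z assms)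

lemma partial_y_coords [simp]:
  "partial_y (\<lambda>q. c) p = 0" "partial_y fst p = 1" "partial_y snd p = 0"
  by (simp_all add: partial_y_def vector_derivative_at[OF has_vector_derivative_id[unfolded id_def]])

lemma partial_z_coords [simp]:
  "partial_z (\<lambda>q. c) p = 0" "partial_z fst p = 0" "partial_z snd p = 1"
  by (simp_all add: partial_z_def vector_derivative_at[OF has_vector_derivative_id[unfolded id_def]])

section \<open>First and second derivatives of the graph\<close>

lemma partial_graph_map:
  assumes "\<phi> differentiable at p"
  shows "partial_y (graph_map \<phi>) p = vector [partial_y \<phi> p, 1, 0]"
    and "partial_z (graph_map \<phi>) p = vector [partial_z \<phi> p, 0, 1]"
proof -
  have "fst differentiable at p" "snd differentiable at p"
    by (auto intro!: bounded_linear_imp_differentiable bounded_linear_fst bounded_linear_snd)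
  with assms show "partial_y (graph_map \<phi>) p = vector [partial_y \<phi> p, 1, 0]"
    and "partial_z (graph_map \<phi>) p = vector [partial_z \<phi> p, 0, 1]"
    by (simp_all add: graph_map_def[abs_def] partial_y_vector_3 partial_z_vector_3)
qed

lemma differentiable_at_cong_open:
  assumes "f differentiable at p" "open S" "p \<in> S" "\<And>q. q \<in> S \<Longrightarrow> f q = g q"
  shows "g differentiable at p"
  using assms has_derivative_transform_within_open unfolding differentiable_def by blast

lemma smooth_on_differentiable:
  "smooth_on S f \<Longrightarrow> p \<in> S \<Longrightarrow> f differentiable at p"
  by (metis smooth_on_def Ck_on.simps(2))

lemma smooth_on_frechet_derivative:
  "smooth_on S f \<Longrightarrow> smooth_on S (\<lambda>x. frechet_derivative f (at x) v)"
  by (metis smooth_on_def Ck_on.simps(2))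

text \<open>On \<open>S\<close> the partial derivative agrees with the Frechet derivative in
  direction \<open>(1, 0)\<close>, which is again smooth; openness of \<open>S\<close> transfers
  differentiability.\<close>

lemma differentiable_partial_y:
  assumes "open S" "smooth_on S \<phi>" "p \<in> S"
  shows "partial_y \<phi> differentiable at p"
  by (rule differentiable_at_cong_open[OF _ assms(1,3)])
    (use assms in \<open>auto simp: partial_y_eq_frechet_derivative smooth_on_differentiable
      intro: smooth_on_differentiable smooth_on_frechet_derivative\<close>)

lemma differentiable_partial_z:
  assumes "open S" "smooth_on S \<phi>" "p \<in> S"
  shows "partial_z \<phi> differentiable at p"
  by (rule differentiable_at_cong_open[OF _ assms(1,3)])
    (use assms in \<open>auto simp: partial_z_eq_frechet_derivative smooth_on_differentiable
      intro: smooth_on_differentiable smooth_on_frechet_derivative\<close>)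

text \<open>The formulas for the first derivatives hold on all of \<open>S\<close>, so locality
  permits differentiating them; their last two components are constant.\<close>

lemma second_partial_graph_map:
  assumes "open S" "smooth_on S \<phi>" "p \<in> S"
  shows "partial_y (partial_y (graph_map \<phi>)) p = vector [partial_y (partial_y \<phi>) p, 0, 0]"
    and "partial_z (partial_y (graph_map \<phi>)) p = vector [partial_z (partial_y \<phi>) p, 0, 0]"
    and "partial_z (partial_z (graph_map \<phi>)) p = vector [partial_z (partial_z \<phi>) p, 0, 0]"
proof -
  note \<phi> = smooth_on_differentiable[OF assms(2)]
  note d = differentiable_partial_y[OF assms] differentiable_partial_z[OF assms]
  show "partial_y (partial_y (graph_map \<phi>)) p = vector [partial_y (partial_y \<phi>) p, 0, 0]"
    using partial_y_cong_open[OF assms(1,3) partial_graph_map(1)[OF \<phi>]] d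
    by (simp add: partial_y_vector_3)
  show "partial_z (partial_y (graph_map \<phi>)) p = vector [partial_z (partial_y \<phi>) p, 0, 0]"
    using partial_z_cong_open[OF assms(1,3) partial_graph_map(1)[OF \<phi>]] d
    by (simp add: partial_z_vector_3)
  show "partial_z (partial_z (graph_map \<phi>)) p = vector [partial_z (partial_z \<phi>) p, 0, 0]"
    using partial_z_cong_open[OF assms(1,3) partial_graph_map(2)[OF \<phi>]] d
    by (simp add: partial_z_vector_3)
qed

section \<open>Causal character from the first fundamental form\<close>

lemma tangent_plane_eq:
  "tangent_plane X p = {s *\<^sub>R partial_y X p + t *\<^sub>R partial_z X p | s t. True}"
  by (auto simp: tangent_plane_def span_insert span_singleton algebra_simps)

lemma lorentz_scaleR_add:
  "lorentz (s *\<^sub>R partial_y X p + t *\<^sub>R partial_z X p) (s' *\<^sub>R partial_y X p + t' *\<^sub>R partial_z X p)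
     = s * s' * coeff_E X p + (s * t' + t * s') * coeff_F X p + t * t' * coeff_G X p"
  by (simp add: lorentz_def coeff_E_def coeff_F_def coeff_G_def algebra_simps)

lemma spacelike_atI:
  assumes "coeff_E X p > 0" "first_form_det X p > 0"
  shows "spacelike_at X p"
  unfolding spacelike_at_def
proof (intro ballI impI)
  fix v assume "v \<in> tangent_plane X p" "v \<noteq> 0"
  then obtain s t where v: "v = s *\<^sub>R partial_y X p + t *\<^sub>R partial_z X p"
    by (auto simp: tangent_plane_eq)
  have "coeff_E X p * lorentz v v
      = (s * coeff_E X p + t * coeff_F X p)\<^sup>2 + t\<^sup>2 * first_form_det X p"
    unfolding v lorentz_scaleR_add first_form_det_def by algebra
  moreover have "\<dots> > 0"
  \<comment> \<open>If \<open>t = 0\<close>, then \<open>v \<noteq> 0\<close> forces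
    \<open>s \<noteq> 0\<close> and the first square is positive; otherwise the determinant term
    is.\<close>
  proof (cases "t = 0")
    case True
    with v \<open>v \<noteq> 0\<close> assms(1) show ?thesis by auto
  next
    case False
    with assms(2) show ?thesis by (intro add_nonneg_pos) auto
  qed
  ultimately show "lorentz v v > 0"
    using assms(1) by (metis zero_less_mult_pos)
qed

lemma timelike_atI:
  assumes "coeff_E X p > 0" "first_form_det X p < 0"
  shows "timelike_at X p"
proof -
  let ?E = "coeff_E X p" and ?F = "coeff_F X p" and ?D = "first_form_det X p"
  \<comment> \<open>Gram-Schmidt: \<open>r\<close> normalises \<open>X_y\<close>. The vector
    \<open>E X_z - F X_y\<close> is orthogonal to \<open>X_y\<close> and has Lorentz square
    \<open>E (E G - F^2) < 0\<close>, which \<open>c\<close> scales to \<open>-1\<close>.\<close>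
  define r c where "r = 1 / sqrt ?E" and "c = 1 / sqrt (- ?D * ?E)"
  have r: "r\<^sup>2 * ?E = 1"
    using assms by (simp add: r_def power_divide)
  have "- ?D * ?E > 0"
    using assms by (simp add: mult_neg_pos)
  then have c: "c\<^sup>2 * (?E * ?D) = - 1"
    using assms by (simp add: c_def power_divide mult.commute)
  let ?u = "r *\<^sub>R partial_y X p + 0 *\<^sub>R partial_z X p"
  let ?v = "(- c * ?F) *\<^sub>R partial_y X p + (c * ?E) *\<^sub>R partial_z X p"
  have "lorentz ?u ?u = 1"
    using r unfolding lorentz_scaleR_add by (simp add: power2_eq_square)
  moreover have "lorentz ?v ?v = - 1"
    using c unfolding lorentz_scaleR_add first_form_det_def by algebra
  moreover have "lorentz ?u ?v = 0"
    unfolding lorentz_scaleR_add by simp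
  moreover have "?u \<in> tangent_plane X p" "?v \<in> tangent_plane X p"
    unfolding tangent_plane_eq by blast+
  ultimately show ?thesis
    unfolding timelike_at_def by blast
qed

text \<open>A vector of Lorentz square \<open>-1\<close> is nonzero, since the zero vector has
  square 0.\<close>

lemma timelike_at_not_spacelike_at: "timelike_at X p \<Longrightarrow> \<not> spacelike_at X p"
  unfolding timelike_at_def spacelike_at_def by (force simp: lorentz_def)

text \<open>Turns the sign, defined through the causal type, into a computable one for normalising
  the normal.\<close>

lemma causal_sign_eq:
  assumes "coeff_E X p > 0" "first_form_det X p \<noteq> 0"
  shows "causal_sign X p = - sgn (first_form_det X p)"
  using assms spacelike_atI[of X p] timelike_atI[of X p] timelike_at_not_spacelike_at[of X p]
  by (auto simp: causal_sign_def sgn_if)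

section \<open>Unit normal and mean curvature of the graph\<close>

lemma coeffs_graph_map:
  assumes "\<phi> differentiable at p"
  shows "coeff_E (graph_map \<phi>) p = (partial_y \<phi> p)\<^sup>2 + 1"
    and "coeff_F (graph_map \<phi>) p = partial_y \<phi> p * partial_z \<phi> p"
    and "coeff_G (graph_map \<phi>) p = (partial_z \<phi> p)\<^sup>2 - 1"
  by (simp_all add: coeff_E_def coeff_F_def coeff_G_def lorentz_def partial_graph_map[OF assms]
      power2_eq_square)

lemma first_form_det_graph_map:
  assumes "\<phi> differentiable at p"
  shows "first_form_det (graph_map \<phi>) p = (partial_z \<phi> p)\<^sup>2 - (partial_y \<phi> p)\<^sup>2 - 1"
  unfolding first_form_det_def coeffs_graph_map[OF assms] by algebra

lemma unit_normal_graph_map_exists: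
  assumes "\<phi> differentiable at p" "first_form_det (graph_map \<phi>) p \<noteq> 0"
  shows "\<exists>N. unit_normal_at (graph_map \<phi>) p N"
proof -
  define D where "D = first_form_det (graph_map \<phi>) p"
  \<comment> \<open>The normal \<open>(1, -\<phi>_y, \<phi>_z)\<close> has Lorentz square
    \<open>1 + \<phi>_y^2 - \<phi>_z^2 = -D\<close>; scaling by \<open>k\<close> leaves
    \<open>- sgn D\<close>, the required causal sign.\<close>
  define k where "k = 1 / sqrt \<bar>D\<bar>"
  let ?N = "vector [k, - k * partial_y \<phi> p, k * partial_z \<phi> p] :: real^3"
  have "coeff_E (graph_map \<phi>) p > 0"
    by (simp add: coeffs_graph_map[OF assms(1)] add_nonneg_pos)
  then have sign: "causal_sign (graph_map \<phi>) p = - sgn D"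
    using causal_sign_eq assms(2) by (simp add: D_def)
  have "lorentz ?N ?N = - (k\<^sup>2 * D)"
    unfolding D_def first_form_det_graph_map[OF assms(1)] lorentz_def vector_3 by algebra
  also have "\<dots> = - sgn D"
    using assms(2) by (simp add: k_def D_def power_divide sgn_if)
  finally have "unit_normal_at (graph_map \<phi>) p ?N"
    unfolding unit_normal_at_def sign by (simp add: partial_graph_map[OF assms(1)] lorentz_def)
  then show ?thesis ..
qed

lemma mean_curvature_graph_map_eq_0:
  assumes "open S" "smooth_on S \<phi>" "p \<in> S" "born_infeld_at \<phi> p"
    and "unit_normal_at (graph_map \<phi>) p N"
  shows "mean_curvature (graph_map \<phi>) N p = 0"
proof -
  have \<phi>: "\<phi> differentiable at p"
    using assms(2,3) by (rule smooth_on_differentiable)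
  let ?yy = "partial_y (partial_y \<phi>) p" and ?yz = "partial_z (partial_y \<phi>) p"
    and ?zz = "partial_z (partial_z \<phi>) p"
  \<comment> \<open>Here \<open>e\<close>, \<open>f\<close>, \<open>g\<close> are
    \<open>N $ 1\<close> times the second partials of \<phi>; factoring out \<open>N $ 1\<close>
    leaves the Born-Infeld expression.\<close>
  have "N $ 1 * ?yy * coeff_G (graph_map \<phi>) p - 2 * (N $ 1 * ?yz) * coeff_F (graph_map \<phi>) p
      + N $ 1 * ?zz * coeff_E (graph_map \<phi>) p = 0"
    using assms(4) unfolding born_infeld_at_def coeffs_graph_map[OF \<phi>] by algebra
  then show ?thesis
    by (simp add: mean_curvature_def Let_def second_partial_graph_map[OF assms(1-3)] lorentz_def)
qed

theorem proposition2p1: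
  fixes \<Omega> :: "(real \<times> real) set" and \<phi> :: "real \<times> real \<Rightarrow> real"
  assumes "open \<Omega>"
    and "smooth_on \<Omega> \<phi>"
    and "\<forall>p\<in>\<Omega>. born_infeld_at \<phi> p"
  shows "minimal_on (graph_map \<phi>) (nonsingular_points (graph_map \<phi>) \<Omega>) \<and>
         (\<forall>p\<in>nonsingular_points (graph_map \<phi>) \<Omega>.
            spacelike_at (graph_map \<phi>) p \<or> timelike_at (graph_map \<phi>) p)"
proof -
  \<comment> \<open>Positivity of \<open>E = \<phi>_y^2 + 1\<close> lets the sign of the determinant
    alone decide the causal type.\<close>
  have *: "\<phi> differentiable at p \<and> coeff_E (graph_map \<phi>) p > 0" if "p \<in> \<Omega>" for p
    using smooth_on_differentiable[OF assms(2) that]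
    by (simp add: coeffs_graph_map add_nonneg_pos)
  have "minimal_on (graph_map \<phi>) (nonsingular_points (graph_map \<phi>) \<Omega>)"
    unfolding minimal_on_def nonsingular_points_def
    using * unit_normal_graph_map_exists mean_curvature_graph_map_eq_0[OF assms(1,2)] assms(3)
    by blast
  moreover have "spacelike_at (graph_map \<phi>) p \<or> timelike_at (graph_map \<phi>) p"
    if "p \<in> nonsingular_points (graph_map \<phi>) \<Omega>" for p
  proof -
    have "p \<in> \<Omega>" "first_form_det (graph_map \<phi>) p > 0 \<or> first_form_det (graph_map \<phi>) p < 0"
      using that by (auto simp: nonsingular_points_def)
    then show ?thesis
      using * spacelike_atI timelike_atI by blast
  qed
  ultimately show ?thesis by blast
qed

end
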